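(* Let $n\ge 1$ be an integer and let $\beta>0$. Let $(Y^\ast,A)$ be generated by the Exponential Random Graph Model with parameter $\beta$ on $n$ nodes. If $$2(\cosh \beta -1) \leq \frac{2\log 2}{n} - \frac{4\log 2}{n^2},$$ then for every (possibly randomized) estimator $\hat Y$ of $Y^\ast$ based on $A$, i.e. every random $\hat Y\in\{+1,-1\}^n$ such that $Y^\ast\to A\to\hat Y$ is a Markov chain, we have $$\mathbb{P}(\hat Y\neq Y^\ast)\ \geq\ \frac12 .$$
   Context: Exponential Random Graph Model with parameter $\beta>0$: a random undirected graph on nodes $1,\dots,n$ with adjacency entries $A_{ij}\in\{0,1\}$, $i<j$. The true label vector $Y^\ast=(y^\ast_1,\dots,y^\ast_n)$ is uniform on $\{+1,-1\}^n$. Conditionally on $Y^\ast=Y=(y_1,\dots,y_n)$, the graph has distribution $$P(A\mid Y)=\frac{\exp\big(\beta\sum_{i<j}A_{ij}y_iy_j\big)}{Z(\beta)},\qquad Z(\beta)=\sum_{A'}\exp\Big(\beta\sum_{i<j}A'_{ij}y_iy_j\Big),$$ where the sum defining $Z(\beta)$ is over all undirected graphs $A'$ on $n$ nodes, i.e. all $(A'_{ij})_{i<j}\in\{0,1\}^{\binom n2}$ (so $Z(\beta)$ may depend on $Y$). $\log$ is the natural logarithm. The Markov chain condition means that $\hat Y$ is conditionally independent of $Y^\ast$ given $A$. *)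

theory Defs
  imports "HOL-Probability.Probability"
begin

definition labels :: "nat \<Rightarrow> (nat \<Rightarrow> real) set" where
  "labels n = {1..n} \<rightarrow>\<^sub>E {1, -1}"

definition node_pairs :: "nat \<Rightarrow> (nat \<times> nat) set" where
  "node_pairs n = {(i, j). 1 \<le> i \<and> i < j \<and> j \<le> n}"

text \<open>An undirected graph on the nodes \<open>1, \<dots>, n\<close>, given by the entries of its adjacency
  matrix above the diagonal.\<close>

definition graphs :: "nat \<Rightarrow> (nat \<times> nat \<Rightarrow> real) set" where
  "graphs n = node_pairs n \<rightarrow>\<^sub>E {0, 1}"

definition ergm_weight :: "nat \<Rightarrow> real \<Rightarrow> (nat \<Rightarrow> real) \<Rightarrow> (nat \<times> nat \<Rightarrow> real) \<Rightarrow> real" where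
  "ergm_weight n \<beta> y a = exp (\<beta> * (\<Sum>(i, j)\<in>node_pairs n. a (i, j) * y i * y j))"

definition ergm_Z :: "nat \<Rightarrow> real \<Rightarrow> (nat \<Rightarrow> real) \<Rightarrow> real" where
  "ergm_Z n \<beta> y = (\<Sum>a\<in>graphs n. ergm_weight n \<beta> y a)"

locale ergm = prob_space M for M :: "'w measure" +
  fixes n :: nat and \<beta> :: real
    and Ystar :: "'w \<Rightarrow> nat \<Rightarrow> real" and A :: "'w \<Rightarrow> nat \<times> nat \<Rightarrow> real"
  assumes measurable_Ystar: "Ystar \<in> measurable M (count_space (labels n))"
    and measurable_A: "A \<in> measurable M (count_space (graphs n))"
    and distr_Ystar: "distr M (count_space (labels n)) Ystar = uniform_count_measure (labels n)"
    and cond_prob_A: "\<And>y a. y \<in> labels n \<Longrightarrow> a \<in> graphs n \<Longrightarrow>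
      \<P>(w in M. A w = a \<bar> Ystar w = y) = ergm_weight n \<beta> y a / ergm_Z n \<beta> y"

text \<open>\<open>X \<rightarrow> Y \<rightarrow> Z\<close> is a Markov chain: \<open>X\<close> and \<open>Z\<close> are conditionally independent given \<open>Y\<close>.
  The pointwise formulation is meant for random variables with countable range.  If \<open>Y = y\<close> has
  probability zero, all three conditional probabilities are zero, so that nothing is required.\<close>

definition discrete_markov_chain ::
    "'w measure \<Rightarrow> ('w \<Rightarrow> 'a) \<Rightarrow> ('w \<Rightarrow> 'b) \<Rightarrow> ('w \<Rightarrow> 'c) \<Rightarrow> bool" where
  "discrete_markov_chain M X Y Z \<longleftrightarrow> (\<forall>x y z.
     \<P>(w in M. X w = x \<and> Z w = z \<bar> Y w = y) =
     \<P>(w in M. X w = x \<bar> Y w = y) * \<P>(w in M. Z w = z \<bar> Y w = y))"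

end

theory Submission
  imports Defs
begin

text \<open>The likelihood of a graph is the same under the labels \<open>y\<close> and \<open>-y\<close>, and the prior is uniform,
  so no label vector has posterior probability above \<open>1/2\<close>. An estimator that depends on the labels
  only through the graph is therefore correct with probability at most \<open>1/2\<close>.\<close>

lemma finite_labels: "finite (labels n)"
  by (simp add: labels_def finite_PiE)

lemma finite_graphs: "finite (graphs n)"
proof -
  have "node_pairs n \<subseteq> {1..n} \<times> {1..n}"
    by (auto simp: node_pairs_def)
  then have "finite (node_pairs n)"
    by (rule finite_subset) simp
  then show ?thesis
    by (simp add: graphs_def finite_PiE)
qed

text \<open>The restriction to \<open>{1..n}\<close> keeps the negated vector extensional, as
  membership in the \<open>PiE\<close> set \<open>labels n\<close> demands.\<close>

definition neg_labels :: "nat \<Rightarrow> (nat \<Rightarrow> real) \<Rightarrow> nat \<Rightarrow> real" where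
  "neg_labels n y = (\<lambda>i\<in>{1..n}. - y i)"

lemma neg_labels_in_labels:
  assumes "y \<in> labels n"
  shows "neg_labels n y \<in> labels n"
  using assms by (fastforce simp: labels_def neg_labels_def PiE_def Pi_def)

text \<open>Node 1 carries a nonzero label, so negation changes it. For \<open>n = 0\<close> the
  only label vector would be its own negative.\<close>

lemma neg_labels_neq:
  assumes "n \<ge> 1" "y \<in> labels n"
  shows "neg_labels n y \<noteq> y"
proof
  assume "neg_labels n y = y"
  then have "neg_labels n y 1 = y 1" by simp
  moreover have "y 1 \<in> {1, -1}"
    using assms PiE_mem[of y "{1..n}" "\<lambda>_. {1, -1}" 1] by (simp add: labels_def)
  ultimately show False
    using assms(1) by (auto simp: neg_labels_def)
qed

text \<open>Each edge contributes a product of two labels, so the two signs cancel; both endpoints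
  lie in \<open>{1..n}\<close>, where \<open>neg_labels\<close> really negates.\<close>

lemma ergm_weight_neg_labels: "ergm_weight n \<beta> (neg_labels n y) a = ergm_weight n \<beta> y a"
proof -
  have "(\<Sum>(i, j)\<in>node_pairs n. a (i, j) * neg_labels n y i * neg_labels n y j)
      = (\<Sum>(i, j)\<in>node_pairs n. a (i, j) * y i * y j)"
    by (rule sum.cong) (auto simp: node_pairs_def neg_labels_def)
  then show ?thesis
    by (simp add: ergm_weight_def)
qed

lemma ergm_Z_neg_labels: "ergm_Z n \<beta> (neg_labels n y) = ergm_Z n \<beta> y"
  by (simp add: ergm_Z_def ergm_weight_neg_labels)

context prob_space
begin

lemma fibre_event:
  assumes "X \<in> measurable M (count_space S)" "x \<in> S"
  shows "{w \<in> space M. X w = x} \<in> events"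
proof -
  have "X -` {x} \<inter> space M \<in> events"
    using assms(2) by (intro measurable_sets[OF assms(1)]) auto
  also have "X -` {x} \<inter> space M = {w \<in> space M. X w = x}" by auto
  finally show ?thesis .
qed

text \<open>Finiteness of \<open>S\<close> lets the event be split by the common value into finitely
  many intersections of fibres.\<close>

lemma equality_event:
  assumes "finite S" "X \<in> measurable M (count_space S)" "Y \<in> measurable M (count_space S)"
  shows "{w \<in> space M. X w = Y w} \<in> events"
proof -
  have "{w \<in> space M. X w = Y w}
      = (\<Union>x\<in>S. {w \<in> space M. X w = x} \<inter> {w \<in> space M. Y w = x})"
    using measurable_space[OF assms(3)] by auto
  also have "\<dots> \<in> events"
    using assms by (intro sets.finite_UN sets.Int fibre_event) auto
  finally show ?thesis .
qed

lemma prob_eq_sum_fibres: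
  assumes "finite S" "X \<in> measurable M (count_space S)" "B \<in> events"
  shows "prob B = (\<Sum>x\<in>S. prob {w \<in> B. X w = x})"
proof -
  have eq: "{w \<in> B. X w = x} = B \<inter> (X -` {x} \<inter> space M)" for x
    using sets.sets_into_space[OF assms(3)] by auto
  have "{w \<in> B. X w = x} \<in> events" if "x \<in> S" for x
    unfolding eq using assms that by (intro sets.Int measurable_sets[OF assms(2)]) auto
  moreover have "B = (\<Union>x\<in>S. {w \<in> B. X w = x})"
    using measurable_space[OF assms(2)] sets.sets_into_space[OF assms(3)] by auto
  ultimately show ?thesis
    using finite_measure_finite_Union[OF assms(1), of "\<lambda>x. {w \<in> B. X w = x}"]
    by (auto simp: disjoint_family_on_def)
qed

text \<open>Given \<open>A = a\<close>, conditional independence turns the success probability into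
  an average of the posteriors of \<open>X\<close>, weighted by the conditional law of
  \<open>Xhat\<close>. An average of numbers at most \<open>c\<close> is at most \<open>c\<close>.
  The posterior bound is stated multiplied out, so that it stays meaningful when
  \<open>A = a\<close> has probability zero.\<close>

lemma markov_estimator_success_le:
  assumes fin: "finite S" "finite T"
    and X: "X \<in> measurable M (count_space S)"
    and A: "A \<in> measurable M (count_space T)"
    and Xhat: "Xhat \<in> measurable M (count_space S)"
    and markov: "discrete_markov_chain M X A Xhat"
    and posterior: "\<And>x a. x \<in> S \<Longrightarrow> a \<in> T \<Longrightarrow>
      prob {w \<in> space M. X w = x \<and> A w = a} \<le> c * prob {w \<in> space M. A w = a}"
  shows "prob {w \<in> space M. Xhat w = X w} \<le> c"
proof -
  note A_event = fibre_event[OF A]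
  note Xhat_event = fibre_event[OF Xhat]
  note eq_event = equality_event[OF fin(1) Xhat X]
  have eqA_event: "{w \<in> space M. Xhat w = X w \<and> A w = a} \<in> events" if "a \<in> T" for a
    using sets.Int[OF eq_event A_event[OF that]] by (simp add: Int_def conj_ac cong: conj_cong)
  have success_le: "prob {w \<in> space M. (X w = x \<and> Xhat w = x) \<and> A w = a}
      \<le> c * prob {w \<in> space M. Xhat w = x \<and> A w = a}"
    (is "?p \<le> c * ?r") if x: "x \<in> S" and a: "a \<in> T" for x a
  proof -
    let ?q = "prob {w \<in> space M. A w = a}"
    show ?thesis
    proof (cases "?q = 0")
      \<comment> \<open>Here the Markov condition only says \<open>0 = 0\<close>, since division by
        zero yields zero; monotonicity makes both sides vanish instead.\<close>
      case True
      have "?p \<le> ?q" "?r \<le> ?q"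
        by (rule finite_measure_mono[OF _ A_event[OF a]]; blast)+
      then have "?p = 0" "?r = 0"
        using True by (simp_all add: measure_le_0_iff)
      then show ?thesis by simp
    next
      case False
      then have q: "?q > 0" by (simp add: order_less_le)
      \<comment> \<open>The Markov condition is taken with the same value \<open>x\<close> for
        \<open>X\<close> and \<open>Xhat\<close>, which is the event of guessing correctly.\<close>
      have "?p / ?q = (prob {w \<in> space M. X w = x \<and> A w = a} / ?q) * (?r / ?q)"
        by (rule markov[unfolded discrete_markov_chain_def cond_prob_def, rule_format])
      also have "\<dots> \<le> c * (?r / ?q)"
        using posterior[OF x a] q by (intro mult_right_mono) (simp_all add: pos_divide_le_eq)
      finally show ?thesis using q by (simp add: pos_divide_le_eq)
    qed
  qed
  have "prob {w \<in> space M. Xhat w = X w}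
      = (\<Sum>a\<in>T. \<Sum>x\<in>S. prob {w \<in> space M. (X w = x \<and> Xhat w = x) \<and> A w = a})"
  proof -
    have "prob {w \<in> space M. Xhat w = X w \<and> A w = a}
        = (\<Sum>x\<in>S. prob {w \<in> space M. (X w = x \<and> Xhat w = x) \<and> A w = a})" if "a \<in> T" for a
      unfolding prob_eq_sum_fibres[OF fin(1) X eqA_event[OF that]]
      by (intro sum.cong arg_cong[where f = prob]) auto
    moreover have "prob {w \<in> space M. Xhat w = X w}
        = (\<Sum>a\<in>T. prob {w \<in> space M. Xhat w = X w \<and> A w = a})"
      unfolding prob_eq_sum_fibres[OF fin(2) A eq_event] by simp
    ultimately show ?thesis
      by simp
  qed
  also have "\<dots> \<le> (\<Sum>a\<in>T. \<Sum>x\<in>S. c * prob {w \<in> space M. Xhat w = x \<and> A w = a})"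
    by (intro sum_mono success_le)
  also have "\<dots> = c * (\<Sum>a\<in>T. \<Sum>x\<in>S. prob {w \<in> space M. Xhat w = x \<and> A w = a})"
    by (simp add: sum_distrib_left)
  \<comment> \<open>The weights left after extracting \<open>c\<close> are the joint law of
    \<open>Xhat\<close> and \<open>A\<close>, so no factor \<open>card S\<close> appears.\<close>
  also have "(\<Sum>a\<in>T. \<Sum>x\<in>S. prob {w \<in> space M. Xhat w = x \<and> A w = a}) = 1"
  proof -
    have "prob {w \<in> space M. A w = a}
        = (\<Sum>x\<in>S. prob {w \<in> space M. Xhat w = x \<and> A w = a})" if "a \<in> T" for a
      unfolding prob_eq_sum_fibres[OF fin(1) Xhat A_event[OF that]]
      by (intro sum.cong arg_cong[where f = prob]) auto
    then have "(\<Sum>a\<in>T. \<Sum>x\<in>S. prob {w \<in> space M. Xhat w = x \<and> A w = a})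
        = (\<Sum>a\<in>T. prob {w \<in> space M. A w = a})"
      by simp
    also have "\<dots> = prob (space M)"
      by (rule prob_eq_sum_fibres[OF fin(2) A sets.top, symmetric])
    finally show ?thesis
      by (simp only: prob_space)
  qed
  finally show ?thesis by simp
qed

end

context ergm
begin

lemma prob_Ystar_eq:
  assumes "y \<in> labels n"
  shows "prob {w \<in> space M. Ystar w = y} = 1 / real (card (labels n))"
proof -
  have "prob {w \<in> space M. Ystar w = y} = measure (distr M (count_space (labels n)) Ystar) {y}"
    using assms by (subst measure_distr[OF measurable_Ystar]) (auto intro: arg_cong[where f = prob])
  also have "\<dots> = 1 / real (card (labels n))"
    using assms unfolding distr_Ystar by (subst measure_uniform_count_measure) (auto simp: finite_labels)
  finally show ?thesis .
qed

text \<open>The joint probability is likelihood times prior: weight and normalising constant are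
  invariant under the sign flip, and the prior is the same constant for both vectors.\<close>

lemma joint_prob_neg_labels:
  assumes "y \<in> labels n" "a \<in> graphs n"
  shows "prob {w \<in> space M. Ystar w = neg_labels n y \<and> A w = a}
    = prob {w \<in> space M. Ystar w = y \<and> A w = a}"
proof -
  have "prob {w \<in> space M. Ystar w = z \<and> A w = a}
      = ergm_weight n \<beta> z a / ergm_Z n \<beta> z / real (card (labels n))" if z: "z \<in> labels n" for z
  proof -
    have "real (card (labels n)) \<noteq> 0"
      using z finite_labels by auto
    have "prob {w \<in> space M. Ystar w = z \<and> A w = a} / (1 / real (card (labels n)))
        = ergm_weight n \<beta> z a / ergm_Z n \<beta> z"
      using cond_prob_A[OF z assms(2)] unfolding cond_prob_def prob_Ystar_eq[OF z]
      by (simp add: conj_commute)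
    then have "prob {w \<in> space M. Ystar w = z \<and> A w = a} * real (card (labels n))
        = ergm_weight n \<beta> z a / ergm_Z n \<beta> z"
      by simp
    then show ?thesis
      by (rule nonzero_eq_divide_eq[OF \<open>real (card (labels n)) \<noteq> 0\<close>, THEN iffD2])
  qed
  then show ?thesis
    using assms(1) neg_labels_in_labels by (simp add: ergm_weight_neg_labels ergm_Z_neg_labels)
qed

text \<open>This is the posterior bound with \<open>c = 1/2\<close>: \<open>y\<close> and its
  negative are distinct and share the mass of \<open>A = a\<close> equally, so neither can hold more
  than half.\<close>

lemma joint_prob_le_half:
  assumes "n \<ge> 1" "y \<in> labels n" "a \<in> graphs n"
  shows "prob {w \<in> space M. Ystar w = y \<and> A w = a} \<le> 1 / 2 * prob {w \<in> space M. A w = a}"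
proof -
  let ?E = "\<lambda>z. {w \<in> space M. Ystar w = z \<and> A w = a}"
  note A_event = fibre_event[OF measurable_A assms(3)]
  have "prob {w \<in> space M. A w = a} = (\<Sum>z\<in>labels n. prob (?E z))"
    unfolding prob_eq_sum_fibres[OF finite_labels measurable_Ystar A_event]
    by (intro sum.cong arg_cong[where f = prob]) auto
  \<comment> \<open>The other label vectors contribute nonnegative terms and are dropped.\<close>
  also have "\<dots> \<ge> (\<Sum>z\<in>{y, neg_labels n y}. prob (?E z))"
    using assms neg_labels_in_labels by (intro sum_mono2 finite_labels) auto
  also have "(\<Sum>z\<in>{y, neg_labels n y}. prob (?E z)) = 2 * prob (?E y)"
    using neg_labels_neq[OF assms(1,2), symmetric] joint_prob_neg_labels[OF assms(2,3)] by simp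
  finally show ?thesis by simp
qed

end

theorem corollary1:
  fixes M :: "'w measure" and n :: nat and \<beta> :: real
    and Ystar Yhat :: "'w \<Rightarrow> nat \<Rightarrow> real" and A :: "'w \<Rightarrow> nat \<times> nat \<Rightarrow> real"
  assumes "n \<ge> 1" and "\<beta> > 0"
    and "ergm M n \<beta> Ystar A"
    and "2 * (cosh \<beta> - 1) \<le> 2 * ln 2 / real n - 4 * ln 2 / (real n)\<^sup>2"
    and "Yhat \<in> measurable M (count_space (labels n))"
    and "discrete_markov_chain M Ystar A Yhat"
  shows "\<P>(w in M. Yhat w \<noteq> Ystar w) \<ge> 1 / 2"
proof -
  interpret ergm M n \<beta> Ystar A by fact
  have "prob {w \<in> space M. Yhat w = Ystar w} \<le> 1 / 2"
    using markov_estimator_success_le[OF finite_labels finite_graphs measurable_Ystar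
        measurable_A assms(5,6) joint_prob_le_half[OF assms(1)]] .
  \<comment> \<open>Measurability of the success event is what allows passing to the complement with
    \<open>prob_neg\<close>.\<close>
  moreover have "{w \<in> space M. Yhat w = Ystar w} \<in> events"
    by (rule equality_event[OF finite_labels assms(5) measurable_Ystar])
  ultimately show ?thesis
    using prob_neg[of "\<lambda>w. Yhat w = Ystar w"] by simp
qed

end
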